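(* For $k>0$, let $f(t)=f(t;k)$ be the solution of $f''(t)=k/f(t)$, $t\ge 0$, with $f(0)=1$ and $f'(0)=w$, where $w=w(k)\ge 0$ is such that $f(1)=1+k$, and let $g(t)=t\sqrt{2k\ln t}$ for $t\ge 1$. Let $k_c$ and, for $0<k<k_c$, $t_1(k)<t_2(k)$ be as defined in the context. Then, for $0<k<k_c$, $$\frac{f(t)}{g(t)}\ \ge\ \frac12\left(\ln\left(\sqrt{2/k}\right)\right)^{-1/2}\qquad\text{when } t_1(k)\le t\le t_2(k),$$ and $$\frac{f(t)}{g(t)}\ \le\ 1.21\qquad\text{when } t\ge t_2(k).$$
   Context: For each $k>0$ there is a unique $w=w(k)\ge 0$ such that the solution of $f''=k/f$ on $[0,\infty)$ with $f(0)=1$, $f'(0)=w$ satisfies $f(1)=1+k$. The number $k_c=1.0384\ldots$ is the unique number such that: (a) for $k\ge k_c$ one has $f(t)\ge g(t)$ for all $t\ge 1$; (b) for $0<k<k_c$ there are $t_1(k),t_2(k)$ with $1<t_1(k)<t_2(k)<\infty$ such that $f(t)<g(t)$ when $t_1(k)<t<t_2(k)$, and $f(t)>g(t)$ when $1\le t<t_1(k)$ or $t>t_2(k)$. The points $t_1(k),t_2(k)$ in the statement are those of (b). *)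

theory Defs
  imports "HOL-Analysis.Analysis"
begin

text \<open>
  \<open>f\<close> solves \<open>f'' = k / f\<close> on \<open>[0, \<infinity>)\<close> with \<open>f 0 = 1\<close>, \<open>f' 0 = w\<close>; the derivatives at \<open>0\<close>
  are one-sided. As division by zero is total in HOL, \<open>f t \<noteq> 0\<close> is required explicitly.
\<close>

definition solves_ivp :: "real \<Rightarrow> real \<Rightarrow> (real \<Rightarrow> real) \<Rightarrow> bool" where
  "solves_ivp k w f \<longleftrightarrow> f 0 = 1 \<and>
     (\<exists>f'. f' 0 = w \<and>
        (\<forall>t\<ge>0. f t \<noteq> 0 \<and>
               (f has_real_derivative f' t) (at t within {0..}) \<and>
               (f' has_real_derivative k / f t) (at t within {0..})))"

text \<open>
  The pair \<open>w(k)\<close>, \<open>f(\<cdot>; k)\<close>, curried with the parameter \<open>k\<close> first. Both are determined by \<open>k\<close>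
  (\<open>f\<close> only on \<open>[0, \<infinity>)\<close>).
\<close>

definition solution_family :: "(real \<Rightarrow> real) \<Rightarrow> (real \<Rightarrow> real \<Rightarrow> real) \<Rightarrow> bool" where
  "solution_family w f \<longleftrightarrow>
     (\<forall>k>0. w k \<ge> 0 \<and> solves_ivp k (w k) (f k) \<and> f k 1 = 1 + k)"

definition g :: "real \<Rightarrow> real \<Rightarrow> real" where
  "g k t = t * sqrt (2 * k * ln t)"

definition crossing_points :: "(real \<Rightarrow> real \<Rightarrow> real) \<Rightarrow> real \<Rightarrow> real \<Rightarrow> real \<Rightarrow> bool" where
  "crossing_points f k t1 t2 \<longleftrightarrow> 1 < t1 \<and> t1 < t2 \<and>
     (\<forall>t. t1 < t \<and> t < t2 \<longrightarrow> f k t < g k t) \<and>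
     (\<forall>t. (1 \<le> t \<and> t < t1) \<or> t2 < t \<longrightarrow> f k t > g k t)"

text \<open>
  At most one \<open>kc\<close> has this property for a given family: if \<open>kc < kc'\<close> both had it, the two
  clauses would contradict each other at \<open>k = kc\<close>. Its value is \<open>1.0384\<dots>\<close>.
\<close>

definition is_critical :: "(real \<Rightarrow> real \<Rightarrow> real) \<Rightarrow> real \<Rightarrow> bool" where
  "is_critical f kc \<longleftrightarrow> 0 < kc \<and>
     (\<forall>k\<ge>kc. \<forall>t\<ge>1. f k t \<ge> g k t) \<and>
     (\<forall>k. 0 < k \<and> k < kc \<longrightarrow> (\<exists>t1 t2. crossing_points f k t1 t2))"

end

theory Submission
  imports Defs
begin

text \<open>
  The energy \<open>f'\<^sup>2 - 2 k ln f\<close> is constant, so with \<open>y = f' / sqrt (2 k)\<close> and \<open>a = y(0)\<close> one has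
  \<open>f = exp (y\<^sup>2 - a\<^sup>2)\<close> and \<open>t * sqrt (k / 2) = f * D\<close>, where
  \<open>D(y) = exp (- y\<^sup>2) * \<integral>\<^sub>a\<^sup>y exp (v\<^sup>2) dv\<close> is a Dawson function with base point \<open>a\<close>, satisfying
  \<open>D' = 1 - 2 y D\<close>. Then \<open>(g / f)\<^sup>2 = 4 D\<^sup>2 ln t\<close> and \<open>ln t = L - a\<^sup>2 + y\<^sup>2 + ln D\<close> with
  \<open>L = ln (sqrt (2 / k))\<close>.

  The upper bound holds because \<open>2 y D \<le> 1.317\<close> makes \<open>f / g\<close> decrease wherever it exceeds
  \<open>1.21\<close>. The lower bound is \<open>D\<^sup>2 ln t \<le> L\<close>, which follows from an inequality of the form
  \<open>y\<^sup>2 + ln D + C \<le> \<lambda> / D\<^sup>2\<close>; the difference of the two sides has a single minimum, located by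
  bounding \<open>D\<close> at one point. The same inequality with \<open>\<lambda> = 1/4\<close> shows \<open>f \<ge> g\<close> for
  \<open>k = 6/5\<close>, hence \<open>k\<^sub>c \<le> 6/5\<close>.
\<close>

subsection \<open>Dawson functions\<close>

text \<open>After the last point with \<open>\<phi> \<ge> 0\<close>, which is \<open>Sup S\<close>,
  the function is negative and hence nondecreasing, so it cannot end below its value there.\<close>

lemma barrier:
  fixes \<phi> \<phi>' :: "real \<Rightarrow> real"
  assumes "a \<le> b" and nonneg: "\<phi> a \<ge> 0"
    and deriv: "\<And>x. a \<le> x \<Longrightarrow> x \<le> b \<Longrightarrow> (\<phi> has_real_derivative \<phi>' x) (at x)"
    and push: "\<And>x. a \<le> x \<Longrightarrow> x \<le> b \<Longrightarrow> \<phi> x < 0 \<Longrightarrow> \<phi>' x \<ge> 0"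
  shows "\<phi> b \<ge> 0"
proof (rule ccontr)
  assume neg: "\<not> \<phi> b \<ge> 0"
  have cont: "continuous_on {a..b} \<phi>"
    by (rule DERIV_continuous_on[of _ _ \<phi>']) (use deriv in \<open>auto intro: DERIV_subset\<close>)
  define S where "S = {x \<in> {a..b}. \<phi> x \<ge> 0}"
  have "S = {a..b} \<inter> \<phi> -` {0..}"
    by (auto simp: S_def)
  then have "closed S"
    using continuous_closed_preimage[OF cont, of "{0..}"] by simp
  moreover have "a \<in> S" using assms by (auto simp: S_def)
  moreover have bdd: "bdd_above S" by (auto simp: S_def)
  ultimately have "Sup S \<in> S"
    using closed_contains_Sup by blast
  then have s: "a \<le> Sup S" "Sup S \<le> b" "\<phi> (Sup S) \<ge> 0"
    by (auto simp: S_def)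
  have below: "\<phi> x < 0" if "Sup S < x" "x \<le> b" for x
    using that s cSup_upper[OF _ bdd, of x] by (force simp: S_def)
  have "\<phi> (Sup S) \<le> \<phi> b"
  proof (rule DERIV_nonneg_imp_increasing_open[where f = \<phi>])
    show "\<exists>y. (\<phi> has_real_derivative y) (at x) \<and> y \<ge> 0" if "Sup S < x" "x < b" for x
      using that s deriv[of x] push[of x] below[of x] by force
    show "continuous_on {Sup S..b} \<phi>"
      using cont continuous_on_subset s by fastforce
  qed (use s in auto)
  with s neg show False by linarith
qed

text \<open>Choice fixes some primitive of exp (x^2) on the whole line; it is used through
  differences, which are the integrals of exp (v^2).\<close>

definition gauss_prim :: "real \<Rightarrow> real" where
  "gauss_prim = (SOME F. \<forall>x. (F has_real_derivative exp (x\<^sup>2)) (at x))"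

lemma gauss_prim_deriv: "(gauss_prim has_real_derivative exp (x\<^sup>2)) (at x)"
proof -
  have "\<exists>F. \<forall>x::real. -\<infinity> < ereal x \<longrightarrow> ereal x < \<infinity> \<longrightarrow>
      (F has_vector_derivative exp (x\<^sup>2)) (at x)"
    by (rule einterval_antiderivative) (auto intro!: continuous_intros)
  then have "\<exists>F. \<forall>x. (F has_real_derivative exp (x\<^sup>2)) (at x)"
    by (simp add: has_real_derivative_iff_has_vector_derivative)
  from someI_ex[OF this] show ?thesis
    unfolding gauss_prim_def by blast
qed

lemma gauss_prim_increment:
  assumes "0 \<le> a" "a \<le> y"
  shows "y - a \<le> gauss_prim y - gauss_prim a"
    and "gauss_prim y - gauss_prim a \<le> (y - a) * exp (y\<^sup>2)"
proof -
  have "y - a \<le> gauss_prim y - gauss_prim a \<and>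
      gauss_prim y - gauss_prim a \<le> (y - a) * exp (y\<^sup>2)"
  proof (cases "a = y")
    case False
    then obtain z where z: "a < z" "z < y"
      and eq: "gauss_prim y - gauss_prim a = (y - a) * exp (z\<^sup>2)"
      using MVT2[of a y gauss_prim "\<lambda>x. exp (x\<^sup>2)"] gauss_prim_deriv assms by auto
    have "1 \<le> exp (z\<^sup>2)" "exp (z\<^sup>2) \<le> exp (y\<^sup>2)"
      using z assms by (auto intro!: power_mono)
    then show ?thesis
      unfolding eq using z by (auto intro!: mult_left_mono)
  qed auto
  then show "y - a \<le> gauss_prim y - gauss_prim a"
    "gauss_prim y - gauss_prim a \<le> (y - a) * exp (y\<^sup>2)" by auto
qed

definition dawson :: "real \<Rightarrow> real \<Rightarrow> real" where
  "dawson a y = exp (- y\<^sup>2) * (gauss_prim y - gauss_prim a)"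

lemma dawson_deriv: "(dawson a has_real_derivative 1 - 2 * y * dawson a y) (at y)"
proof -
  have "exp (- y\<^sup>2) * exp (y\<^sup>2) = 1"
    by (simp flip: exp_add)
  then show ?thesis
    unfolding dawson_def[abs_def]
    by (auto intro!: derivative_eq_intros gauss_prim_deriv simp: algebra_simps)
qed

lemma dawson_self [simp]: "dawson a a = 0"
  by (simp add: dawson_def)

lemma dawson_pos:
  assumes "0 \<le> a" "a < y"
  shows "dawson a y > 0"
  using gauss_prim_increment(1)[of a y] assms by (simp add: dawson_def)

lemma dawson_nonneg:
  assumes "0 \<le> a" "a \<le> y"
  shows "dawson a y \<ge> 0"
  using gauss_prim_increment(1)[of a y] assms by (simp add: dawson_def)

lemma dawson_le_self:
  assumes "0 \<le> a" "a \<le> y"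
  shows "dawson a y \<le> y"
proof -
  have "dawson a y \<le> exp (- y\<^sup>2) * ((y - a) * exp (y\<^sup>2))"
    unfolding dawson_def using gauss_prim_increment(2)[OF assms] by (intro mult_left_mono) auto
  also have "\<dots> = y - a"
    by (simp add: exp_minus)
  finally show ?thesis using assms by simp
qed

text \<open>Moving the base point from 0 to a removes exp (-y^2) times the integral of exp (v^2)
  over [0, a], which is at least a.\<close>

lemma dawson_le_0:
  assumes "0 \<le> a"
  shows "dawson a y \<le> dawson 0 y - a * exp (- y\<^sup>2)"
proof -
  have "exp (- y\<^sup>2) * a \<le> exp (- y\<^sup>2) * (gauss_prim a - gauss_prim 0)"
    using gauss_prim_increment(1)[of 0 a] assms by (intro mult_left_mono) auto
  then show ?thesis
    by (simp add: dawson_def algebra_simps)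
qed

text \<open>With s = 1 / sqrt 2: up to s the bound D \<le> y suffices; beyond s, D > s would give 2
  y D > 1, so D' < 0.\<close>

lemma dawson_sq_le:
  assumes "0 \<le> a" "a \<le> y"
  shows "(dawson a y)\<^sup>2 \<le> 1/2"
proof -
  define s where "s = sqrt (1/2)"
  have s: "s > 0" "s * s = 1/2" by (auto simp: s_def)
  have "dawson a y \<le> s"
  proof (cases "y \<le> s")
    case True
    then show ?thesis using dawson_le_self[OF assms] by linarith
  next
    case False
    define m where "m = max a s"
    have m: "a \<le> m" "s \<le> m" "m \<le> y" using False assms by (auto simp: m_def)
    have "s - dawson a y \<ge> 0"
    proof (rule barrier[where a = m and \<phi> = "\<lambda>y. s - dawson a y"
            and \<phi>' = "\<lambda>y. - (1 - 2 * y * dawson a y)"])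
      show "s - dawson a m \<ge> 0"
        using dawson_le_self[of a s] s assms by (auto simp: m_def max_def)
      show "((\<lambda>y. s - dawson a y) has_real_derivative - (1 - 2 * x * dawson a x)) (at x)" for x
        by (auto intro!: derivative_eq_intros dawson_deriv)
      show "0 \<le> - (1 - 2 * x * dawson a x)" if "m \<le> x" "s - dawson a x < 0" for x
        using mult_mono[of s x s "dawson a x"] that m s by auto
    qed (use m in auto)
    then show ?thesis by simp
  qed
  then show ?thesis
    using power_mono[of "dawson a y" s 2] dawson_nonneg[OF assms] s by (simp add: power2_eq_square)
qed

text \<open>
  Dawson's function is \<open>y * dhorner \<infinity> 0 (y\<^sup>2)\<close>: these are the truncations of its alternating
  Taylor series in Horner form, and \<open>drem\<close> is the defect in the differential equation.
\<close>

primrec dhorner :: "nat \<Rightarrow> nat \<Rightarrow> real \<Rightarrow> real" where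
  "dhorner 0 n x = 1"
| "dhorner (Suc k) n x = 1 - 2 * x / (2 * real n + 3) * dhorner k (Suc n) x"

primrec drem :: "nat \<Rightarrow> nat \<Rightarrow> real \<Rightarrow> real" where
  "drem 0 n y = 2 * y ^ (2 * n + 2)"
| "drem (Suc k) n y = - 2 / (2 * real n + 3) * drem k (Suc n) y"

lemma dhorner_numeral:
  "dhorner (numeral k) n x =
     1 - 2 * x / (2 * real n + 3) * dhorner (pred_numeral k) (Suc n) x"
  by (simp add: numeral_eq_Suc)

lemma drem_even_nonneg: "y \<ge> 0 \<Longrightarrow> drem (2 * m) n y \<ge> 0"
  by (induction m arbitrary: n) (auto intro!: mult_nonneg_nonneg divide_nonneg_nonneg)

text \<open>Each Horner step passes from y^(2n+1) to y^(2n+3), so the induction must range over all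
  n. The case n = 0 is Dawson's equation with defect \<open>drem k 0 y\<close>.\<close>

lemma dhorner_deriv:
  "((\<lambda>y. y ^ (2 * n + 1) * dhorner k n (y\<^sup>2)) has_real_derivative
     (2 * real n + 1) * y ^ (2 * n) + drem k n y - 2 * y * (y ^ (2 * n + 1) * dhorner k n (y\<^sup>2)))
   (at y)"
proof (induction k arbitrary: n)
  case 0
  have "((\<lambda>y. y ^ (2 * n + 1)) has_real_derivative (2 * real n + 1) * y ^ (2 * n)) (at y)"
    by (rule derivative_eq_intros refl | simp)+
  moreover have "drem 0 n y = 2 * y * y ^ (2 * n + 1)"
    by simp
  ultimately show ?case
    by (simp del: drem.simps)
next
  case (Suc k)
  let ?T = "\<lambda>y. y ^ (2 * Suc n + 1) * dhorner k (Suc n) (y\<^sup>2)"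
  have eq: "y ^ (2 * n + 1) * dhorner (Suc k) n (y\<^sup>2) = y ^ (2 * n + 1) - 2 / (2 * real n + 3) * ?T y"
    for y :: real
    by (simp add: algebra_simps power2_eq_square)
  have "((\<lambda>y. y ^ (2 * n + 1) - 2 / (2 * real n + 3) * ?T y) has_real_derivative
      (2 * real n + 1) * y ^ (2 * n) - 2 / (2 * real n + 3) *
       ((2 * real (Suc n) + 1) * y ^ (2 * Suc n) + drem k (Suc n) y - 2 * y * ?T y)) (at y)"
    by (intro DERIV_diff DERIV_cmult Suc.IH) (rule derivative_eq_intros refl | simp)+
  moreover have "2 / (2 * real n + 3) * ((2 * real (Suc n) + 1) * y ^ (2 * Suc n)) = 2 * y * y ^ (2 * n + 1)"
    by (simp add: field_simps)
  then have "(2 * real n + 1) * y ^ (2 * n) - 2 / (2 * real n + 3) *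
       ((2 * real (Suc n) + 1) * y ^ (2 * Suc n) + drem k (Suc n) y - 2 * y * ?T y) =
     (2 * real n + 1) * y ^ (2 * n) + drem (Suc k) n y -
       2 * y * (y ^ (2 * n + 1) - 2 / (2 * real n + 3) * ?T y)"
    unfolding ring_distribs drem.simps by simp
  ultimately show ?case
    unfolding eq by metis
qed

text \<open>For an even number of steps the defect is nonnegative, so after multiplication by the
  integrating factor exp (y^2) the truncation grows at least as fast as
  \<open>gauss_prim\<close>.\<close>

lemma dawson_le_dhorner:
  assumes "0 \<le> y"
  shows "dawson 0 y \<le> y * dhorner (2 * m) 0 (y\<^sup>2)"
proof -
  let ?h = "\<lambda>y. y * dhorner (2 * m) 0 (y\<^sup>2)"
  let ?f = "\<lambda>y. exp (y\<^sup>2) * ?h y - gauss_prim y"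
  have "?f 0 \<le> ?f y"
  proof (rule DERIV_nonneg_imp_nondecreasing[OF assms, of ?f])
    fix x :: real
    assume "0 \<le> x"
    have "(?h has_real_derivative 1 + drem (2 * m) 0 x - 2 * x * ?h x) (at x)"
      using dhorner_deriv[of 0 "2 * m" x] by simp
    moreover have "((\<lambda>x. exp (x\<^sup>2)) has_real_derivative exp (x\<^sup>2) * (2 * x)) (at x)"
      by (auto intro!: derivative_eq_intros)
    ultimately have "(?f has_real_derivative exp (x\<^sup>2) * (2 * x) * ?h x +
        (1 + drem (2 * m) 0 x - 2 * x * ?h x) * exp (x\<^sup>2) - exp (x\<^sup>2)) (at x)"
      by (intro DERIV_diff DERIV_mult gauss_prim_deriv)
    then have "(?f has_real_derivative exp (x\<^sup>2) * drem (2 * m) 0 x) (at x)"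
      by (simp add: algebra_simps)
    moreover have "exp (x\<^sup>2) * drem (2 * m) 0 x \<ge> 0"
      using drem_even_nonneg[OF \<open>0 \<le> x\<close>] by simp
    ultimately show "\<exists>D. (?f has_real_derivative D) (at x) \<and> D \<ge> 0" by blast
  qed
  then have "gauss_prim y - gauss_prim 0 \<le> exp (y\<^sup>2) * ?h y"
    by simp
  then have "dawson 0 y \<le> exp (- y\<^sup>2) * (exp (y\<^sup>2) * ?h y)"
    unfolding dawson_def by (intro mult_left_mono) auto
  also have "\<dots> = ?h y"
    by (simp flip: mult.assoc exp_add)
  finally show ?thesis .
qed

section \<open>Numerical bounds for Dawson's function and exp\<close>

lemma dawson_145: "dawson 0 (29/20) \<le> 4433/10000"
  using dawson_le_dhorner[of "29/20" 4] by (simp add: dhorner_numeral power_divide)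

text \<open>This point and 627/322 are the values of 1 / (2 d) + d / (4 lam) for (d, lam) = (9/20,
  34/100) and (7/23, 1/4).\<close>

lemma dawson_144: "dawson 0 (1765/1224) \<le> 4455/10000"
  using dawson_le_dhorner[of "1765/1224" 4] by (simp add: dhorner_numeral power_divide)

lemma dawson_195: "dawson 0 (627/322) \<le> 3127/10000"
  using dawson_le_dhorner[of "627/322" 7] by (simp add: dhorner_numeral power_divide)

text \<open>Raising to the power q and using e < 2.72 reduces the bound to a comparison of rational
  powers.\<close>

lemma exp_quotient_le:
  fixes b :: real
  assumes "0 < q" "0 \<le> b" "(272/100) ^ p \<le> b ^ q"
  shows "exp (real p / real q) \<le> b"
proof -
  have "exp (real p / real q) ^ q = exp 1 ^ p"
    using assms by (simp flip: exp_of_nat_mult)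
  also have "\<dots> \<le> (272/100) ^ p"
    using e_less_272 by (intro power_mono) auto
  also have "\<dots> \<le> b ^ q"
    by (rule assms)
  finally show ?thesis
    using assms by (subst (asm) power_mono_iff) auto
qed

subsection \<open>Logarithmic bounds\<close>

text \<open>On the curve where \<open>\<kappa>\<close> below vanishes, y is this function of D. Its
  monotonicity turns comparisons of y into comparisons of D.\<close>

lemma balance_strict_antimono:
  fixes u v lam :: real
  assumes "0 < u" "u < v" "u * v < 2 * lam"
  shows "1 / (2 * v) + v / (4 * lam) < 1 / (2 * u) + u / (4 * lam)"
proof -
  have lam: "lam > 0" using assms mult_pos_pos[of u v] by linarith
  have "1 / (2 * u) + u / (4 * lam) - (1 / (2 * v) + v / (4 * lam)) =
      (v - u) * (2 * lam - u * v) / (4 * lam * u * v)"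
    using assms lam by (simp add: field_simps)
  also have "\<dots> > 0"
    using assms lam by simp
  finally show ?thesis by simp
qed

text \<open>
  The difference \<open>\<psi>\<close> of the two sides satisfies \<open>\<psi>' = 4 \<lambda> \<kappa> / D\<^sup>2\<close>, where
  \<open>\<kappa> = y - 1 / (2 D) - D / (4 \<lambda>)\<close> is increasing as long as it is negative, and where \<open>\<kappa> = 0\<close>
  one has \<open>\<psi> = crit D - C\<close> with \<open>crit\<close> decreasing. The hypothesis \<open>D(Y) < d\<close> says that \<open>\<kappa>\<close> is
  still negative at \<open>Y\<close>, so that \<open>D \<le> d\<close> at the minimum of \<open>\<psi>\<close>.
\<close>

lemma dawson_log_bound:
  fixes lam d a y Y C :: real
  assumes lam: "lam \<ge> 1/4" and d: "0 < d" "d\<^sup>2 < 2 * lam"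
    and Y: "Y = 1 / (2 * d) + d / (4 * lam)"
    and a: "0 \<le> a" "a < Y" and DY: "dawson a Y < d"
    and C: "C \<le> (lam - 1/4) / d\<^sup>2 - 1 / (4 * lam) - d\<^sup>2 / (16 * lam\<^sup>2) - ln d"
    and y: "a < y"
  shows "y\<^sup>2 + ln (dawson a y) + C \<le> lam / (dawson a y)\<^sup>2"
proof -
  define crit where "crit v = (lam - 1/4) / v\<^sup>2 - 1 / (4 * lam) - v\<^sup>2 / (16 * lam\<^sup>2) - ln v" for v
  define \<kappa> where "\<kappa> z = z - 1 / (2 * dawson a z) - dawson a z / (4 * lam)" for z
  define \<psi> where "\<psi> z = lam / (dawson a z)\<^sup>2 - ln (dawson a z) - z\<^sup>2 - C" for z
  define \<kappa>' where "\<kappa>' z = 1 - (2 * z * dawson a z - 1) * (1 / (2 * (dawson a z)\<^sup>2) - 1 / (4 * lam))" for z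
  define \<psi>' where "\<psi>' z = 4 * lam * \<kappa> z / (dawson a z)\<^sup>2" for z
  have pos: "dawson a z > 0" if "z > a" for z
    using dawson_pos a that by simp
  have sq: "(dawson a z)\<^sup>2 \<le> 2 * lam" if "z > a" for z
    using dawson_sq_le[of a z] a that lam by simp
  have crit_eq: "lam / v\<^sup>2 - ln v - (1 / (2 * v) + v / (4 * lam))\<^sup>2 = crit v" if "v > 0" for v
    unfolding crit_def using that lam by (simp add: field_simps power2_eq_square)
  have crit_mono: "crit d \<le> crit v" if "0 < v" "v \<le> d" for v
  proof -
    have "v\<^sup>2 \<le> d\<^sup>2" "ln v \<le> ln d" using that by (auto intro: power_mono)
    moreover from this have "(lam - 1/4) / d\<^sup>2 \<le> (lam - 1/4) / v\<^sup>2"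
      using that lam by (intro divide_left_mono) auto
    moreover have "v\<^sup>2 / (16 * lam\<^sup>2) \<le> d\<^sup>2 / (16 * lam\<^sup>2)"
      using \<open>v\<^sup>2 \<le> d\<^sup>2\<close> by (intro divide_right_mono) auto
    ultimately show ?thesis unfolding crit_def by linarith
  qed
  have \<kappa>_deriv: "(\<kappa> has_real_derivative \<kappa>' z) (at z)" if "z > a" for z
    unfolding \<kappa>_def[abs_def] \<kappa>'_def using pos[OF that] lam
    by (auto intro!: derivative_eq_intros dawson_deriv simp: field_simps power2_eq_square)
  have \<psi>_deriv: "(\<psi> has_real_derivative \<psi>' z) (at z)" if "z > a" for z
    unfolding \<psi>_def[abs_def] \<psi>'_def \<kappa>_def using pos[OF that] lam
    by (auto intro!: derivative_eq_intros dawson_deriv simp: field_simps power2_eq_square)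
  have \<kappa>_Y: "\<kappa> Y < 0"
  proof -
    have "dawson a Y * d < d * d" using DY d by simp
    then have "dawson a Y * d < 2 * lam" using d(2) unfolding power2_eq_square by linarith
    from balance_strict_antimono[OF pos[OF a(2)] DY this] show ?thesis
      unfolding \<kappa>_def Y[symmetric] by linarith
  qed
  \<comment> \<open>Y is where \<open>\<kappa>\<close> would vanish if D were d. Since D(Y) < d,
    replacing D by d only lowers the value, to crit d - C.\<close>
  have \<psi>_Y: "\<psi> Y \<ge> 0"
  proof -
    have "(dawson a Y)\<^sup>2 \<le> d\<^sup>2" "ln (dawson a Y) \<le> ln d"
      using pos[OF a(2)] DY by (auto intro!: power_mono)
    moreover from this have "lam / d\<^sup>2 \<le> lam / (dawson a Y)\<^sup>2"
      using pos[OF a(2)] d lam by (intro divide_left_mono) auto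
    moreover have "lam / d\<^sup>2 - ln d - Y\<^sup>2 = crit d"
      using crit_eq[OF d(1)] unfolding Y .
    ultimately show ?thesis using C unfolding \<psi>_def crit_def by linarith
  qed
  have "\<psi> y \<ge> 0"
  proof (cases "y \<ge> Y")
    case True
    show ?thesis
    proof (rule barrier[where \<phi> = \<psi>, OF True \<psi>_Y])
      fix x assume x: "Y \<le> x"
      then have ax: "a < x" using a by linarith
      show "(\<psi> has_real_derivative \<psi>' x) (at x)" by (rule \<psi>_deriv[OF ax])
      \<comment> \<open>The contrapositive of what the barrier needs. D > d would put the zero curve
        of \<open>\<kappa>\<close> below Y \<le> x, so D \<le> d and \<open>\<psi>\<close> x \<ge>
        crit D - C \<ge> crit d - C.\<close>
      have "\<psi> x \<ge> 0" if "\<kappa> x < 0"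
      proof -
        let ?D = "dawson a x"
        have x_less: "x < 1 / (2 * ?D) + ?D / (4 * lam)"
          using that unfolding \<kappa>_def by linarith
        have "?D \<le> d"
        proof (rule ccontr)
          assume "\<not> ?D \<le> d"
          then have "d * ?D < ?D * ?D" "d < ?D" using d by auto
          then have "d * ?D < 2 * lam" using sq[OF ax] by (simp add: power2_eq_square)
          from balance_strict_antimono[OF d(1) \<open>d < ?D\<close> this] x x_less Y show False by linarith
        qed
        then have "crit d \<le> crit ?D" using crit_mono pos[OF ax] by blast
        moreover have "x\<^sup>2 \<le> (1 / (2 * ?D) + ?D / (4 * lam))\<^sup>2"
          using x_less ax a by (intro power_mono) auto
        ultimately show ?thesis
          using crit_eq[OF pos[OF ax]] C unfolding \<psi>_def crit_def[of d] by linarith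
      qed
      then show "\<psi>' x \<ge> 0" if "\<psi> x < 0"
        using that lam unfolding \<psi>'_def by (intro divide_nonneg_nonneg mult_nonneg_nonneg) force+
    qed
  next
    case False
    \<comment> \<open>Left of Y, once \<open>\<kappa>\<close> is nonnegative it stays so, by the
      barrier, contradicting its sign at Y. Hence \<open>\<psi>\<close> decreases up to Y.\<close>
    have \<kappa>_nonpos: "\<kappa> z \<le> 0" if z: "y \<le> z" "z \<le> Y" for z
    proof (rule ccontr)
      assume "\<not> \<kappa> z \<le> 0"
      then have "\<kappa> z \<ge> 0" by simp
      have "\<kappa> Y \<ge> 0"
      proof (rule barrier[where \<phi> = \<kappa>, OF z(2) \<open>\<kappa> z \<ge> 0\<close>])
        fix x assume x: "z \<le> x"
        then have ax: "a < x" using y z by linarith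
        show "(\<kappa> has_real_derivative \<kappa>' x) (at x)" by (rule \<kappa>_deriv[OF ax])
        assume "\<kappa> x < 0"
        let ?D = "dawson a x"
        let ?q = "1 / (2 * ?D\<^sup>2) - 1 / (4 * lam)"
        have D: "?D > 0" using pos[OF ax] .
        have q: "?q \<ge> 0"
          using sq[OF ax] D lam by (simp add: field_simps)
        have "2 * x * ?D - 1 \<le> ?D\<^sup>2 / (2 * lam)"
          using \<open>\<kappa> x < 0\<close> D lam unfolding \<kappa>_def by (simp add: field_simps power2_eq_square)
        then have "(2 * x * ?D - 1) * ?q \<le> ?D\<^sup>2 / (2 * lam) * ?q"
          using q by (intro mult_right_mono)
        also have "\<dots> = 1 / (4 * lam) - ?D\<^sup>2 / (8 * lam\<^sup>2)"
          using D lam by (simp add: field_simps power2_eq_square)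
        also have "\<dots> \<le> 1"
        proof -
          have "1 / (4 * lam) \<le> 1" using lam by (simp add: field_simps)
          then show ?thesis by (smt (verit) zero_le_divide_iff zero_le_power2)
        qed
        finally show "\<kappa>' x \<ge> 0" unfolding \<kappa>'_def by simp
      qed
      with \<kappa>_Y show False by simp
    qed
    have "\<psi> Y \<le> \<psi> y"
    proof (rule DERIV_nonpos_imp_nonincreasing[where f = \<psi>])
      show "y \<le> Y" using False by simp
      fix x assume x: "y \<le> x" "x \<le> Y"
      have "\<psi>' x \<le> 0"
        unfolding \<psi>'_def using \<kappa>_nonpos[OF x] lam
        by (intro divide_nonpos_nonneg mult_nonneg_nonpos) auto
      then show "\<exists>D. (\<psi> has_real_derivative D) (at x) \<and> D \<le> 0"
        using \<psi>_deriv[of x] x y by auto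
    qed
    with \<psi>_Y show ?thesis by simp
  qed
  then show ?thesis unfolding \<psi>_def by simp
qed

text \<open>Serves 1 \<le> k \<le> 6/5. The bound 0.3127 at base point 0 exceeds d = 7/23; the
  correction a exp (-Y^2) \<ge> (2/5) / 46 brings D(Y) below d.\<close>

lemma dawson_log_bound_quarter:
  assumes a: "2/5 \<le> a" "a < 627/322" and y: "a < y"
  shows "y\<^sup>2 + ln (dawson a y) + 9/100 \<le> (1/4) / (dawson a y)\<^sup>2"
proof (rule dawson_log_bound[where d = "7/23" and Y = "627/322"])
  have "exp (627/322 * (627/322) :: real) \<le> exp (19/5)"
    by simp
  also have "\<dots> \<le> 46"
    using exp_quotient_le[of 5 46 19] by (simp add: power_divide)
  finally have "exp (627/322 * (627/322) :: real) \<le> 46" .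
  then have "exp (- (627/322)\<^sup>2 :: real) \<ge> 1/46"
    by (simp add: exp_minus field_simps power2_eq_square)
  then have "2/5 * (1/46) \<le> a * exp (- (627/322)\<^sup>2)"
    using a by (intro mult_mono) auto
  then show "dawson a (627/322) < 7/23"
    using dawson_le_0[of a "627/322"] dawson_195 a by simp
  have "exp (32/27 :: real) \<le> 23/7"
    using exp_quotient_le[of 27 "23/7" 32] by (simp add: power_divide)
  then have "32/27 \<le> ln (23/7 :: real)"
    by (subst ln_ge_iff) auto
  then have "ln (7/23 :: real) \<le> - 32/27"
    by (simp add: ln_div)
  then show "9/100 \<le> (1/4 - 1/4) / (7/23)\<^sup>2 - 1 / (4 * (1/4)) - (7/23)\<^sup>2 / (16 * (1/4)\<^sup>2) - ln (7/23 :: real)"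
    by (simp add: power_divide)
qed (use a y in \<open>auto simp: power2_eq_square\<close>)

text \<open>Serves k < 1, where L \<ge> 34/100; here the bound at base point 0 is already below
  d.\<close>

lemma dawson_log_bound_34:
  assumes a: "0 \<le> a" "a < 1" and y: "a < y"
  shows "y\<^sup>2 + ln (dawson a y) + 34/100 \<le> (34/100) / (dawson a y)\<^sup>2"
proof (rule dawson_log_bound[where d = "9/20" and Y = "1765/1224"])
  have "a * exp (- (1765/1224)\<^sup>2) \<ge> 0"
    using a by simp
  then show "dawson a (1765/1224) < 9/20"
    using dawson_le_0[of a "1765/1224"] dawson_144 a by linarith
  have "exp (3/4 :: real) \<le> 20/9"
    using exp_quotient_le[of 4 "20/9" 3] by (simp add: power_divide)
  then have "3/4 \<le> ln (20/9 :: real)"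
    by (subst ln_ge_iff) auto
  then have "ln (9/20 :: real) \<le> - 3/4"
    by (simp add: ln_div)
  then show "34/100 \<le> (34/100 - 1/4) / (9/20)\<^sup>2 - 1 / (4 * (34/100)) - (9/20)\<^sup>2 / (16 * (34/100)\<^sup>2) - ln (9/20 :: real)"
    by (simp add: power_divide)
qed (use a y in \<open>auto simp: power2_eq_square\<close>)

text \<open>
  The constant is \<open>2 z\<^sup>2 / (2 z\<^sup>2 - 1)\<close> at \<open>z = 29/20\<close>, chosen so that \<open>const / y - 2 D\<close>, weighted by
  \<open>exp (y\<^sup>2)\<close>, is smallest exactly at \<open>z\<close>. It has to stay below \<open>2 - 1 / 1.21\<^sup>2\<close>.
\<close>

lemma dawson_times_le:
  assumes a: "0 \<le> a" "a \<le> y"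
  shows "2 * y * dawson a y \<le> 841/641"
proof -
  have D0: "2 * y * dawson 0 y \<le> 841/641" if y: "y > 0" for y
  proof -
    \<comment> \<open>Up to an additive constant, half of the weighted difference; its derivative
      vanishes at y^2 = 841/400 = (29/20)^2.\<close>
    let ?f = "\<lambda>y. (841/1282) * exp (y\<^sup>2) / y - gauss_prim y"
    let ?f' = "\<lambda>y. exp (y\<^sup>2) * (200/641 - (841/1282) / y\<^sup>2)"
    have deriv: "(?f has_real_derivative ?f' x) (at x)" if "x > 0" for x
      using that by (auto intro!: derivative_eq_intros gauss_prim_deriv simp: field_simps power2_eq_square)
    have "?f (29/20) \<le> ?f y"
    proof (cases "y \<ge> 29/20")
      case True
      show ?thesis
      proof (rule DERIV_nonneg_imp_nondecreasing[OF True, of ?f])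
        fix x :: real assume "29/20 \<le> x"
        then have "x > 0" "(29/20)\<^sup>2 \<le> x\<^sup>2" by (linarith, intro power_mono) auto
        then have "?f' x \<ge> 0" by (intro mult_nonneg_nonneg) (auto simp: field_simps power2_eq_square)
        then show "\<exists>D. (?f has_real_derivative D) (at x) \<and> D \<ge> 0"
          using deriv[OF \<open>x > 0\<close>] by blast
      qed
    next
      case False
      then have le: "y \<le> 29/20" by simp
      show ?thesis
      proof (rule DERIV_nonpos_imp_nonincreasing[OF le, of ?f])
        fix x :: real assume x: "y \<le> x" "x \<le> 29/20"
        then have "x > 0" "x\<^sup>2 \<le> (29/20)\<^sup>2" using y by (linarith, intro power_mono) auto
        then have "?f' x \<le> 0" by (intro mult_nonneg_nonpos) (auto simp: field_simps power2_eq_square)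
        then show "\<exists>D. (?f has_real_derivative D) (at x) \<and> D \<le> 0"
          using deriv[OF \<open>x > 0\<close>] by blast
      qed
    qed
    moreover have "gauss_prim z - gauss_prim 0 = exp (z\<^sup>2) * dawson 0 z" for z
      by (simp add: dawson_def flip: mult.assoc exp_add)
    ultimately have "exp ((29/20)\<^sup>2) * (841/1282 / (29/20) - dawson 0 (29/20)) \<le>
        exp (y\<^sup>2) * (841/1282 / y - dawson 0 y)"
      by (smt (verit, ccfv_SIG) right_diff_distrib times_divide_eq_right mult.commute)
    moreover have "exp ((29/20)\<^sup>2) * (841/1282 / (29/20) - dawson 0 (29/20)) \<ge> 0"
      using dawson_145 by (intro mult_nonneg_nonneg) auto
    ultimately have "841/1282 / y - dawson 0 y \<ge> 0"
      by (smt (verit, ccfv_SIG) exp_gt_zero zero_le_mult_iff)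
    then show ?thesis using y by (simp add: field_simps)
  qed
  show ?thesis
  proof (cases "y = 0")
    case False
    have "a * exp (- y\<^sup>2) \<ge> 0" using a by simp
    then have "dawson a y \<le> dawson 0 y" using dawson_le_0[of a y] a by linarith
    then have "2 * y * dawson a y \<le> 2 * y * dawson 0 y"
      using a by (intro mult_left_mono) auto
    moreover have "y > 0" using False a by simp
    ultimately show ?thesis using D0[of y] by linarith
  qed auto
qed

text \<open>With c = 1.21^2, the difference weighted by exp (y^2) has derivative 2 D exp (y^2) (2 c
  - 1 - 2 c y D), nonnegative because 841/641 \<le> 2 - 1 / c.\<close>

lemma dawson_quadratic_bound:
  assumes a: "0 \<le> a" "a \<le> y"
  shows "2 * y * dawson a y - 1 \<le> 2 * (14641/10000) * (dawson a y)\<^sup>2"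
proof -
  let ?D = "dawson a"
  define c :: real where "c = 14641/10000"
  let ?f = "\<lambda>y. exp (y\<^sup>2) * (2 * c * (?D y)\<^sup>2 + 1 - 2 * y * ?D y)"
  have "?f a \<le> ?f y"
  proof (rule DERIV_nonneg_imp_nondecreasing[OF a(2), of ?f])
    fix x assume x: "a \<le> x"
    have "(?f has_real_derivative 2 * ?D x * exp (x\<^sup>2) * (2 * c - 1 - c * (2 * x * ?D x))) (at x)"
      by (rule derivative_eq_intros dawson_deriv refl)+ (simp add: algebra_simps power2_eq_square)
    moreover have "2 * c - 1 - c * (2 * x * ?D x) \<ge> 0"
      using dawson_times_le[of a x] a x by (simp add: c_def)
    then have "2 * ?D x * exp (x\<^sup>2) * (2 * c - 1 - c * (2 * x * ?D x)) \<ge> 0"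
      using dawson_nonneg[of a x] a x by (intro mult_nonneg_nonneg) auto
    ultimately show "\<exists>D. (?f has_real_derivative D) (at x) \<and> D \<ge> 0" by blast
  qed
  moreover have "?f a > 0" by simp
  ultimately have "?f y > 0" by linarith
  then show ?thesis by (simp add: c_def zero_less_mult_iff)
qed

text \<open>For B = L - a^2, l is ln t as a function of y, and l' = 1 / D. The derivative of D^2 l
  is D (1 - 2 (2 z D - 1) l); by the quadratic bound it is nonnegative whenever 4 c D^2 l < 1, which
  is a barrier.\<close>

lemma dawson_sq_log_persists:
  fixes a B :: real
  defines "l \<equiv> \<lambda>z. B + z\<^sup>2 + ln (dawson a z)"
  assumes a: "0 \<le> a" "a < x" "x \<le> y" and l: "l x \<ge> 0"
    and x: "1 / (4 * (14641/10000)) \<le> (dawson a x)\<^sup>2 * l x"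
  shows "1 / (4 * (14641/10000)) \<le> (dawson a y)\<^sup>2 * l y"
proof -
  define c :: real where "c = 14641/10000"
  let ?D = "dawson a"
  define \<phi> where "\<phi> z = (?D z)\<^sup>2 * l z - 1 / (4 * c)" for z
  have pos: "?D z > 0" if "x \<le> z" for z
    using dawson_pos that a by simp
  have l_deriv: "(l has_real_derivative 1 / ?D z) (at z)" if "x \<le> z" for z
    unfolding l_def using pos[OF that]
    by (auto intro!: derivative_eq_intros dawson_deriv simp: field_simps)
  have l_nonneg: "l z \<ge> 0" if "x \<le> z" for z
  proof -
    have "l x \<le> l z"
    proof (rule DERIV_nonneg_imp_nondecreasing[OF that, of l])
      show "\<exists>d. (l has_real_derivative d) (at u) \<and> d \<ge> 0" if "x \<le> u" for u
        using l_deriv[OF that] pos[OF that] by (intro exI[of _ "1 / ?D u"]) simp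
    qed
    with l show ?thesis by simp
  qed
  have "\<phi> y \<ge> 0"
  proof (rule barrier[where \<phi> = \<phi>, OF a(3)])
    show "\<phi> x \<ge> 0" using x by (simp add: \<phi>_def c_def)
    fix z assume z: "x \<le> z"
    show "(\<phi> has_real_derivative ?D z * (1 - 2 * (2 * z * ?D z - 1) * l z)) (at z)"
      unfolding \<phi>_def[abs_def] using pos[OF z]
      by (auto intro!: derivative_eq_intros dawson_deriv l_deriv[OF z]
          simp: field_simps power2_eq_square)
    assume neg: "\<phi> z < 0"
    have "2 * (2 * z * ?D z - 1) * l z \<le> 2 * (2 * c * (?D z)\<^sup>2) * l z"
      using dawson_quadratic_bound[of a z] a z l_nonneg[OF z] unfolding c_def
      by (intro mult_right_mono mult_left_mono) auto
    also have "\<dots> \<le> 1"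
      using neg by (simp add: \<phi>_def c_def)
    finally show "?D z * (1 - 2 * (2 * z * ?D z - 1) * l z) \<ge> 0"
      using pos[OF z] by simp
  qed
  then show ?thesis
    by (simp add: \<phi>_def c_def)
qed

subsection \<open>The trajectory as a Dawson function\<close>

text \<open>Handles the one-sided derivative at 0: inside the interval it is two-sided, and at the
  endpoints continuity is enough.\<close>

lemma mono_of_deriv_within:
  fixes h h' :: "real \<Rightarrow> real"
  assumes "0 \<le> s" "s \<le> t"
    and deriv: "\<And>x. 0 \<le> x \<Longrightarrow> (h has_real_derivative h' x) (at x within {0..})"
    and nonneg: "\<And>x. s \<le> x \<Longrightarrow> x \<le> t \<Longrightarrow> h' x \<ge> 0"
  shows "h s \<le> h t"
proof (rule DERIV_nonneg_imp_increasing_open[OF assms(2), of h])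
  show "\<exists>y. (h has_real_derivative y) (at x) \<and> y \<ge> 0" if "s < x" "x < t" for x
  proof -
    have "at x within {0..} = at x"
      using that assms(1) by (intro at_within_interior) (simp add: interior_real_atLeast)
    then show ?thesis
      using deriv[of x] nonneg[of x] that assms(1) by (intro exI[of _ "h' x"]) simp
  qed
  have "continuous_on {0..} h"
    by (rule DERIV_continuous_on) (use deriv in auto)
  then show "continuous_on {s..t} h"
    by (rule continuous_on_subset) (use assms in auto)
qed

lemma const_of_deriv_within:
  fixes h :: "real \<Rightarrow> real"
  assumes "0 \<le> t" "\<And>x. 0 \<le> x \<Longrightarrow> (h has_real_derivative 0) (at x within {0..})"
  shows "h t = h 0"
proof (rule antisym)
  show "h 0 \<le> h t"
    by (rule mono_of_deriv_within[OF _ assms]) auto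
  have "((\<lambda>x. - h x) has_real_derivative 0) (at x within {0..})" if "0 \<le> x" for x
    using DERIV_minus[OF assms(2)[OF that]] by simp
  then have "- h 0 \<le> - h t"
    using assms(1) by (intro mono_of_deriv_within[where h = "\<lambda>x. - h x" and h' = "\<lambda>_. 0"]) auto
  then show "h t \<le> h 0" by simp
qed

section \<open>Energy conservation and the change of variable from t to y\<close>

locale trajectory =
  fixes k w :: real and f f' :: "real \<Rightarrow> real"
  assumes k: "k > 0" and w: "w \<ge> 0"
    and f_0: "f 0 = 1" and f'_0: "f' 0 = w" and f_1: "f 1 = 1 + k"
    and f_nz: "\<And>t. 0 \<le> t \<Longrightarrow> f t \<noteq> 0"
    and f_deriv: "\<And>t. 0 \<le> t \<Longrightarrow> (f has_real_derivative f' t) (at t within {0..})"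
    and f'_deriv: "\<And>t. 0 \<le> t \<Longrightarrow> (f' has_real_derivative k / f t) (at t within {0..})"
begin

definition a :: real where "a = w / sqrt (2 * k)"

definition y :: "real \<Rightarrow> real" where "y t = f' t / sqrt (2 * k)"

definition L :: real where "L = ln (sqrt (2 / k))"

definition D :: "real \<Rightarrow> real" where "D t = dawson a (y t)"

lemma f_cont: "continuous_on {0..} f"
  by (rule DERIV_continuous_on) (use f_deriv in auto)

lemma f_pos:
  assumes "0 \<le> t"
  shows "f t > 0"
proof (rule ccontr)
  assume "\<not> f t > 0"
  then obtain x where "0 \<le> x" "f x = 0"
    using IVT2'[of f t 0 0] assms f_0 continuous_on_subset[OF f_cont, of "{0..t}"] by auto
  with f_nz show False by blast
qed

lemma f'_mono:
  assumes "0 \<le> s" "s \<le> t"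
  shows "f' s \<le> f' t"
  by (rule mono_of_deriv_within[OF assms f'_deriv]) (use k f_pos assms in \<open>auto intro: less_imp_le\<close>)

lemma y_mono: "0 \<le> s \<Longrightarrow> s \<le> t \<Longrightarrow> y s \<le> y t"
  using f'_mono k by (simp add: y_def divide_right_mono)

lemma y_0: "y 0 = a"
  by (simp add: y_def a_def f'_0)

lemma a_nonneg: "a \<ge> 0"
  using w k by (simp add: a_def)

lemma a_sq: "a\<^sup>2 = w\<^sup>2 / (2 * k)"
  using k by (simp add: a_def power_divide)

lemma f_eq_exp:
  assumes "0 \<le> t"
  shows "f t = exp ((y t)\<^sup>2 - a\<^sup>2)"
proof -
  have "(f' t)\<^sup>2 - 2 * k * ln (f t) = (f' 0)\<^sup>2 - 2 * k * ln (f 0)"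
  proof (rule const_of_deriv_within[OF assms])
    fix x :: real assume "0 \<le> x"
    then show "((\<lambda>t. (f' t)\<^sup>2 - 2 * k * ln (f t)) has_real_derivative 0) (at x within {0..})"
      using f_pos by (auto intro!: derivative_eq_intros f_deriv f'_deriv)
  qed
  then have "ln (f t) = (y t)\<^sup>2 - a\<^sup>2"
    using k by (simp add: a_sq y_def power_divide f_0 f'_0 field_simps)
  then show ?thesis
    using f_pos[OF assms] by (metis exp_ln)
qed

text \<open>By the energy identity exp (y^2) y' is the constant exp (a^2) sqrt (k / 2), so
  \<open>gauss_prim (y t)\<close> is affine in t.\<close>

lemma f_times_D:
  assumes "0 \<le> t"
  shows "t * sqrt (k / 2) = f t * D t"
proof -
  define c where "c = exp (a\<^sup>2) * sqrt (k / 2)"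
  have "gauss_prim (y t) - c * t = gauss_prim (y 0) - c * 0"
  proof (rule const_of_deriv_within[OF assms])
    fix x :: real assume x: "0 \<le> x"
    have "(y has_real_derivative k / f x / sqrt (2 * k)) (at x within {0..})"
      unfolding y_def[abs_def] by (intro DERIV_cdivide f'_deriv x)
    then have deriv: "((\<lambda>t. gauss_prim (y t) - c * t) has_real_derivative
        exp ((y x)\<^sup>2) * (k / f x / sqrt (2 * k)) - c) (at x within {0..})"
      by (intro DERIV_diff DERIV_chain2[OF gauss_prim_deriv]) (auto intro!: derivative_eq_intros)
    have "exp ((y x)\<^sup>2) = exp (a\<^sup>2) * f x"
      by (simp add: f_eq_exp[OF x] flip: exp_add)
    moreover have "k / sqrt (2 * k) = sqrt (k / 2)"
      using k by (simp add: real_sqrt_mult real_sqrt_divide field_simps)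
    moreover have "exp (a\<^sup>2) * f x * (k / f x / sqrt (2 * k)) = exp (a\<^sup>2) * (k / sqrt (2 * k))"
      using f_pos[OF x] by simp
    ultimately have "exp ((y x)\<^sup>2) * (k / f x / sqrt (2 * k)) = c"
      by (simp only: c_def)
    with deriv show "((\<lambda>t. gauss_prim (y t) - c * t) has_real_derivative 0) (at x within {0..})"
      by simp
  qed
  then have "t * sqrt (k / 2) = exp (- a\<^sup>2) * (gauss_prim (y t) - gauss_prim a)"
    by (simp add: c_def y_0 exp_minus field_simps)
  also have "exp (- a\<^sup>2) = exp ((y t)\<^sup>2 - a\<^sup>2) * exp (- (y t)\<^sup>2)"
    by (simp flip: exp_add)
  finally show ?thesis
    by (simp add: D_def dawson_def f_eq_exp[OF assms])
qed

lemma
  assumes "0 < t"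
  shows a_less_y: "a < y t" and D_pos: "D t > 0"
    and ln_t: "ln t = L - a\<^sup>2 + (y t)\<^sup>2 + ln (D t)"
proof -
  have t: "0 < t * sqrt (k / 2)" "0 < f t"
    using assms k f_pos[of t] by auto
  then show D: "D t > 0"
    using f_times_D[of t] assms by (simp add: zero_less_mult_iff)
  then have "y t \<noteq> a"
    by (auto simp: D_def)
  with y_mono[of 0 t] y_0 assms show "a < y t"
    by simp
  have "ln (t * sqrt (k / 2)) = ln (f t * D t)"
    using f_times_D[of t] assms by simp
  moreover have "ln (k / 2) = - ln (2 / k)"
    using k by (simp add: ln_div)
  then have "ln (sqrt (k / 2)) = - L"
    using k by (simp add: L_def ln_sqrt)
  moreover have "ln (f t) = (y t)\<^sup>2 - a\<^sup>2"
    using f_eq_exp[of t] assms by simp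
  ultimately show "ln t = L - a\<^sup>2 + (y t)\<^sup>2 + ln (D t)"
    using assms k t D by (simp add: ln_mult)
qed

lemma ratio:
  assumes "1 < t"
  shows "g k t > 0" and "f t / g k t = 1 / (2 * (D t * sqrt (ln t)))"
proof -
  show "g k t > 0" using assms k by (simp add: g_def)
  have "D t > 0" using D_pos assms by simp
  then have "f t = t * sqrt (k / 2) / D t"
    using f_times_D[of t] assms by (simp add: field_simps)
  moreover have "sqrt (2 * k * ln t) = 2 * sqrt (k / 2) * sqrt (ln t)"
  proof -
    have "sqrt (2 * k * ln t) = sqrt (2\<^sup>2 * (k / 2) * ln t)"
      by simp
    then show ?thesis
      by (simp only: real_sqrt_mult real_sqrt_abs abs_numeral)
  qed
  moreover have "sqrt (k / 2) > 0" using k by simp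
  ultimately show "f t / g k t = 1 / (2 * (D t * sqrt (ln t)))"
    using assms \<open>D t > 0\<close> unfolding g_def by (simp add: divide_simps)
qed

section \<open>Bounds on the initial slope\<close>

lemma f_ge_tangent:
  assumes "0 \<le> t"
  shows "f t \<ge> 1 + w * t"
proof -
  have "f 0 - w * 0 \<le> f t - w * t"
    by (rule mono_of_deriv_within[where h' = "\<lambda>x. f' x - w", OF _ assms])
       (use f'_mono[of 0] f'_0 in \<open>auto intro!: derivative_eq_intros f_deriv\<close>)
  then show ?thesis by (simp add: f_0)
qed

lemma w_le: "w \<le> k"
  using f_ge_tangent[of 1] f_1 by simp

lemma a_sq_le: "a\<^sup>2 \<le> k / 2"
proof -
  have "w\<^sup>2 \<le> k\<^sup>2" using w w_le by (intro power_mono)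
  then show ?thesis using k unfolding a_sq by (simp add: field_simps power2_eq_square)
qed

text \<open>The tangent bound gives f'' \<le> k / (1 + w t) \<le> k (1 - w t + w^2 t^2); integrate
  twice over [0, 1] and insert f(1) = 1 + k.\<close>

lemma w_lower: "k / 2 \<le> w - k * w / 6 + k * w\<^sup>2 / 12"
proof -
  let ?h = "\<lambda>t. w + k * (t - w * t\<^sup>2 / 2 + w\<^sup>2 * t ^ 3 / 3) - f' t"
  have h_deriv: "(?h has_real_derivative k * (1 - w * x + w\<^sup>2 * x\<^sup>2) - k / f x) (at x within {0..})"
    if "0 \<le> x" for x
    by (rule derivative_eq_intros f'_deriv that refl | simp)+
  have "?h 0 \<le> ?h t" if "0 \<le> t" for t
  proof (rule mono_of_deriv_within[OF _ that h_deriv])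
    fix x :: real assume x: "0 \<le> x"
    have wx: "0 \<le> w * x" using w x by simp
    have "k / f x \<le> k / (1 + w * x)"
      using f_ge_tangent[OF x] f_pos[OF x] wx k by (intro divide_left_mono mult_pos_pos) auto
    also have "\<dots> \<le> k * (1 - w * x + (w * x)\<^sup>2)"
    proof -
      have "1 \<le> (1 - w * x + (w * x)\<^sup>2) * (1 + w * x)"
        using zero_le_power[OF wx, of 3] by (simp add: algebra_simps power2_eq_square power3_eq_cube)
      then show ?thesis using wx k by (simp add: divide_le_eq)
    qed
    finally show "k * (1 - w * x + w\<^sup>2 * x\<^sup>2) - k / f x \<ge> 0"
      by (simp add: power_mult_distrib)
  qed auto
  then have h_nonneg: "?h t \<ge> 0" if "0 \<le> t" for t
    using that f'_0 by fastforce
  let ?H = "\<lambda>t. 1 + w * t + k * (t\<^sup>2 / 2 - w * t ^ 3 / 6 + w\<^sup>2 * t ^ 4 / 12) - f t"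
  have H_deriv: "(?H has_real_derivative ?h x) (at x within {0..})" if "0 \<le> x" for x
    by (rule derivative_eq_intros f_deriv that refl | simp add: algebra_simps)+
  have "?H 0 \<le> ?H 1"
    by (rule mono_of_deriv_within[OF _ _ H_deriv]) (use h_nonneg in auto)
  then show ?thesis
    by (simp add: f_0 f_1 algebra_simps)
qed

lemma a_sq_ge:
  assumes "1 \<le> k" "k \<le> 6/5"
  shows "a\<^sup>2 \<ge> 16/100"
proof (rule ccontr)
  assume "\<not> ?thesis"
  then have w2: "w\<^sup>2 < 32/100 * k"
    using k by (simp add: a_sq field_simps)
  \<comment> \<open>566/1000 approximates sqrt 0.32, the bound on w at k = 1. Linearising there
    bounds w by an affine function of k, which contradicts \<open>w_lower\<close>.\<close>
  have "0 \<le> (w - 566/1000)\<^sup>2" by simp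
  then have "w \<le> (w\<^sup>2 / (566/1000) + 566/1000) / 2"
    by (simp add: power2_eq_square field_simps)
  also have "\<dots> \<le> 283/1000 * k + 283/1000"
    using w2 k by simp
  finally have "w * (1 - k / 6) \<le> (283/1000 * k + 283/1000) * (1 - k / 6)"
    using assms by (intro mult_right_mono) auto
  moreover have "k * w\<^sup>2 / 12 \<le> k * (32/100 * k) / 12"
    using w2 k by (intro divide_right_mono mult_left_mono) auto
  moreover have "k \<le> k * k" using assms by simp
  moreover have "(283/1000 * k + 283/1000) * (1 - k / 6) =
      283/1000 + 283/1200 * k - 283/6000 * (k * k)"
    by (simp add: field_simps)
  moreover have "k * (32/100 * k) / 12 = 32/1200 * (k * k)"
    by simp
  moreover have "k / 2 \<le> w * (1 - k / 6) + k * w\<^sup>2 / 12"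
    using w_lower by (simp add: algebra_simps)
  ultimately show False using assms by linarith
qed

lemma a_range:
  assumes "1 \<le> k" "k \<le> 6/5"
  shows "2/5 \<le> a" "a < 627/322"
proof -
  have "(2/5)\<^sup>2 \<le> a\<^sup>2" "a\<^sup>2 < (627/322)\<^sup>2"
    using a_sq_ge[OF assms] a_sq_le assms(2) by (simp_all add: power_divide)
  then show "2/5 \<le> a" "a < 627/322"
    using a_nonneg power2_le_imp_le[of "2/5" a] power2_less_imp_less[of a "627/322"] by simp_all
qed

lemma a_sq_ge_critical:
  assumes "k = 6/5"
  shows "a\<^sup>2 \<ge> 19/100"
proof -
  \<comment> \<open>Chosen so that w^2 / (12/5) still exceeds 19/100.\<close>
  have "w \<ge> 676/1000"
  proof (rule ccontr)
    assume "\<not> ?thesis"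
    then have "w < 676/1000" "w * w \<le> 676/1000 * (676/1000)"
      using w by (simp, intro mult_mono) auto
    then show False using w_lower unfolding assms by (simp add: power2_eq_square)
  qed
  then have "w\<^sup>2 \<ge> (676/1000)\<^sup>2" by (intro power_mono) auto
  then show ?thesis unfolding a_sq unfolding assms by (simp add: power2_eq_square)
qed

section \<open>The two bounds on f / g along a trajectory\<close>

lemma L_ge:
  assumes "exp (2 * x) \<le> b" "k \<le> 2 / b"
  shows "x \<le> L"
proof -
  have "b > 0" using assms(1) exp_gt_zero[of "2 * x"] by linarith
  then have "exp (2 * x) \<le> 2 / k"
    using assms k by (intro order.trans[OF assms(1)]) (simp add: field_simps)
  then have "2 * x \<le> ln (2 / k)"
    using k by (subst ln_ge_iff) auto
  then show ?thesis using k by (simp add: L_def ln_sqrt)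
qed

lemma f_ge_g_critical:
  assumes "k = 6/5" "1 < t"
  shows "g k t \<le> f t"
proof -
  have t: "0 < t" using assms by simp
  have "(5/3 :: real) \<le> exp (56/100)"
    using exp_lower_Taylor_quadratic[of "56/100 :: real"] by (simp add: power2_eq_square)
  then have "ln (5/3 :: real) \<le> 56/100"
    using ln_le_cancel_iff[of "5/3" "exp (56/100)"] by simp
  then have "L \<le> 28/100"
    unfolding L_def unfolding assms by (simp add: ln_sqrt)
  \<comment> \<open>28/100 - 19/100 is exactly the constant of
    \<open>dawson_log_bound_quarter\<close>.\<close>
  then have LC: "L - a\<^sup>2 \<le> 9/100" using a_sq_ge_critical[OF assms(1)] by simp
  have "2/5 \<le> a" "a < 627/322" by (rule a_range; use assms(1) in linarith)+
  from dawson_log_bound_quarter[OF this a_less_y[OF t]] LC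
  have "ln t \<le> (1/4) / (D t)\<^sup>2"
    unfolding ln_t[OF t] D_def by linarith
  then have "(2 * (D t * sqrt (ln t)))\<^sup>2 \<le> 1\<^sup>2"
    using D_pos[OF t] assms(2) by (simp add: power_mult_distrib field_simps)
  then have "2 * (D t * sqrt (ln t)) \<le> 1"
    by (rule power2_le_imp_le) simp
  then have "1 \<le> f t / g k t"
    unfolding ratio(2)[OF assms(2)] using D_pos[OF t] assms(2) by (simp add: divide_simps)
  then show ?thesis using ratio(1)[OF assms(2)] by (simp add: field_simps)
qed

lemma
  assumes "k < 6/5"
  shows L_ge_quarter: "L \<ge> 1/4"
    and D_sq_ln_le: "1 < t \<Longrightarrow> (D t)\<^sup>2 * ln t \<le> L"
proof -
  have "exp (2 * (1/4)) \<le> (5/3 :: real)"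
    using exp_quotient_le[of 2 "5/3" 1] by (simp add: power2_eq_square)
  from L_ge[OF this] assms show L: "L \<ge> 1/4" by simp
  \<comment> \<open>Any lam \<le> L will do: the surplus L - lam in ln t is multiplied by D^2 \<le>
    1.\<close>
  have bound: "(D t)\<^sup>2 * ln t \<le> L" if "1 < t" and lam: "lam \<le> L"
    and C: "(y t)\<^sup>2 + ln (D t) + (lam - a\<^sup>2) \<le> lam / (D t)\<^sup>2" for lam
  proof -
    have pos: "(D t)\<^sup>2 > 0" using D_pos[of t] that by simp
    have "(D t)\<^sup>2 \<le> 1"
      using dawson_sq_le[of a "y t"] a_nonneg a_less_y[of t] that by (simp add: D_def)
    then have "(L - lam) * (D t)\<^sup>2 \<le> L - lam"
      using lam by (simp add: mult_left_le)
    moreover define E where "E = (y t)\<^sup>2 + ln (D t) + (lam - a\<^sup>2)"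
    then have "E \<le> lam / (D t)\<^sup>2"
      using C by simp
    then have "E * (D t)\<^sup>2 \<le> lam"
      using pos by (simp add: pos_le_divide_eq)
    moreover have "ln t = E + (L - lam)"
      using ln_t[of t] that by (simp add: E_def)
    then have "(D t)\<^sup>2 * ln t = E * (D t)\<^sup>2 + (L - lam) * (D t)\<^sup>2"
      by (simp only: mult.commute[of "(D t)\<^sup>2"] distrib_right)
    ultimately show ?thesis by linarith
  qed
  assume t: "1 < t"
  then have ay: "a < y t" using a_less_y by simp
  show "(D t)\<^sup>2 * ln t \<le> L"
  proof (cases "k < 1")
    case True
    have "exp (2 * (34/100)) \<le> (2 :: real)"
      using exp_quotient_le[of 25 2 17] by (simp add: power_divide)
    from L_ge[OF this] True have "L \<ge> 34/100" by simp
    have "a\<^sup>2 < 1\<^sup>2" using a_sq_le True by simp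
    then have "a < 1" by (rule power2_less_imp_less) simp
    from dawson_log_bound_34[OF a_nonneg this ay]
    have "(y t)\<^sup>2 + ln (D t) + (34/100 - a\<^sup>2) \<le> (34/100) / (D t)\<^sup>2"
      using zero_le_power2[of a] unfolding D_def by linarith
    with t \<open>L \<ge> 34/100\<close> show ?thesis by (rule bound)
  next
    case False
    have k1: "1 \<le> k" "k \<le> 6/5" using False assms by auto
    \<comment> \<open>Here lam = 1/4, and a^2 \<ge> 16/100 gives lam - a^2 \<le> 9/100.\<close>
    from dawson_log_bound_quarter[OF a_range[OF k1] ay]
    have "(y t)\<^sup>2 + ln (D t) + (1/4 - a\<^sup>2) \<le> (1/4) / (D t)\<^sup>2"
      using a_sq_ge[OF k1] unfolding D_def by linarith
    with t L show ?thesis by (rule bound)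
  qed
qed

lemma ratio_lower:
  assumes "k < 6/5" "1 < t"
  shows "1 / 2 * L powr (- 1 / 2) \<le> f t / g k t"
proof -
  have t: "D t > 0" "ln t > 0" using D_pos assms by auto
  have "D t * sqrt (ln t) = sqrt ((D t)\<^sup>2 * ln t)"
    using t by (simp add: real_sqrt_mult)
  also have "\<dots> \<le> sqrt L"
    using D_sq_ln_le[OF assms] by simp
  finally have "1 / (2 * sqrt L) \<le> 1 / (2 * (D t * sqrt (ln t)))"
    using t L_ge_quarter[OF assms(1)] by (intro divide_left_mono) (auto intro!: mult_pos_pos)
  moreover have "L powr (- 1 / 2) = 1 / sqrt L"
    using L_ge_quarter[OF assms(1)] by (simp add: powr_minus_divide powr_half_sqrt)
  ultimately show ?thesis
    unfolding ratio(2)[OF assms(2)] by simp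
qed

lemma ratio_le_iff:
  assumes "1 < t"
  shows "f t / g k t \<le> 1.21 \<longleftrightarrow> 1 / (4 * (14641/10000)) \<le> (D t)\<^sup>2 * ln t"
proof -
  have t: "D t > 0" "ln t > 0" using D_pos assms by auto
  let ?q = "D t * sqrt (ln t)"
  \<comment> \<open>50/121 = 1 / (2 * 1.21).\<close>
  have "f t / g k t \<le> 1.21 \<longleftrightarrow> 50/121 \<le> ?q"
    unfolding ratio(2)[OF assms] using t by (simp add: field_simps)
  also have "\<dots> \<longleftrightarrow> (50/121)\<^sup>2 \<le> ?q\<^sup>2"
    using t by (subst power_mono_iff) auto
  also have "?q\<^sup>2 = (D t)\<^sup>2 * ln t"
    using t by (simp add: power_mult_distrib)
  finally show ?thesis
    by (simp add: power_divide)
qed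

lemma ratio_upper:
  assumes "1 < s" "s \<le> t" "f s \<le> g k s"
  shows "f t / g k t \<le> 1.21"
proof -
  have "f s / g k s \<le> 1.21"
    using ratio(1)[OF assms(1)] assms(3) by (simp add: field_simps)
  moreover have "ln s \<ge> 0" using assms by simp
  ultimately show ?thesis
    using dawson_sq_log_persists[of a "y s" "y t" "L - a\<^sup>2"] assms
      ratio_le_iff[of s] ratio_le_iff[of t] ln_t[of s] ln_t[of t]
      a_nonneg a_less_y[of s] y_mono[of s t]
    by (simp add: D_def)
qed

end

lemma solution_family_trajectory:
  assumes "solution_family w f" "k > 0"
  obtains f' where "trajectory k (w k) (f k) f'"
proof -
  from assms have *: "w k \<ge> 0" "solves_ivp k (w k) (f k)" "f k 1 = 1 + k"
    by (auto simp: solution_family_def)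
  from *(2) obtain f' where "f k 0 = 1" "f' 0 = w k"
    "\<forall>t\<ge>0. f k t \<noteq> 0 \<and> (f k has_real_derivative f' t) (at t within {0..}) \<and>
       (f' has_real_derivative k / f k t) (at t within {0..})"
    unfolding solves_ivp_def by blast
  with * assms(2) have "trajectory k (w k) (f k) f'"
    unfolding trajectory_def by auto
  with that show thesis .
qed

theorem theorem3p3:
  fixes w :: "real \<Rightarrow> real" and f :: "real \<Rightarrow> real \<Rightarrow> real" and kc k t1 t2 :: real
  assumes "solution_family w f"
    and "is_critical f kc"
    and "0 < k" and "k < kc"
    and "crossing_points f k t1 t2"
  shows "(\<forall>t. t1 \<le> t \<and> t \<le> t2 \<longrightarrow>
            f k t / g k t \<ge> 1 / 2 * (ln (sqrt (2 / k))) powr (- 1 / 2)) \<and>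
         (\<forall>t\<ge>t2. f k t / g k t \<le> 1.21)"
proof -
  \<comment> \<open>Otherwise k = 6/5 would have crossing points, with f < g at their
    midpoint.\<close>
  have "kc \<le> 6/5"
  proof (rule ccontr)
    assume "\<not> kc \<le> 6/5"
    then obtain s1 s2 where "crossing_points f (6/5) s1 s2"
      using assms(2) unfolding is_critical_def by force
    then have s: "1 < (s1 + s2) / 2" "f (6/5) ((s1 + s2) / 2) < g (6/5) ((s1 + s2) / 2)"
      by (auto simp: crossing_points_def)
    obtain f' where "trajectory (6/5) (w (6/5)) (f (6/5)) f'"
      using solution_family_trajectory[OF assms(1), of "6/5"] by auto
    from trajectory.f_ge_g_critical[OF this refl s(1)] s(2) show False by simp
  qed
  with assms have k: "k < 6/5" by simp
  obtain f' where tr: "trajectory k (w k) (f k) f'"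
    using solution_family_trajectory[OF assms(1,3)] .
  have t12: "1 < t1" "t1 < t2" and below: "\<And>t. t1 < t \<Longrightarrow> t < t2 \<Longrightarrow> f k t < g k t"
    using assms(5) by (auto simp: crossing_points_def)
  \<comment> \<open>The crossing property is strict and omits t2 itself; the left limit supplies the
    starting point for the upper bound.\<close>
  have "f k t2 \<le> g k t2"
  proof (rule tendsto_le[of "at_left t2"])
    have "isCont (f k) t2"
      using trajectory.f_cont[OF tr] t12
      by (intro continuous_on_interior[of "{0..}"]) (auto simp: interior_real_atLeast)
    then show "((f k) \<longlongrightarrow> f k t2) (at_left t2)"
      by (simp add: isCont_def filterlim_at_split)
    have "isCont (g k) t2"
      unfolding g_def[abs_def] using t12 by (auto intro!: continuous_intros)
    then show "((g k) \<longlongrightarrow> g k t2) (at_left t2)"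
      by (simp add: isCont_def filterlim_at_split)
    show "\<forall>\<^sub>F t in at_left t2. f k t \<le> g k t"
      using eventually_at_left_real[OF t12(2)]
      by eventually_elim (use below in \<open>auto intro: less_imp_le\<close>)
  qed auto
  then show ?thesis
    using trajectory.ratio_lower[OF tr k] trajectory.ratio_upper[OF tr, of t2] t12
    unfolding trajectory.L_def[OF tr] by auto
qed

end
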